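(* Let $n\geq 3$ and let $\Gamma=(V,E)$ be a finite $(n-1,n)$-sparse multigraph. Then there is a nonempty Zariski open subset $O\subseteq Z_{1,n}(\Gamma)$ such that $H^1(\Gamma,\mathcal{F})=0$ for every $\mathcal{F}\in O$.
   Context: Let $\mathbb{V}$ be a real vector space of dimension $n$, $1\le s\le n/2$. For a multigraph $\Gamma=(V,E)$, $Z_{s,n}(\Gamma)$ is the set of tuples $((S_v)_{v\in V},(\alpha_e)_{e\in E})\in\mathrm{Gr}(s,\mathbb{V})^{|V|}\times(\mathbb{V}^* )^{E}$ such that $\alpha_e(S_v)=0$ whenever $v\in e$, and $S_u\cap S_v=\{0\}$ for all distinct $u,v\in V$. It is a subset of a real algebraic variety, with $\mathrm{Gr}(s,\mathbb{R}^n)$ realised as the affine variety of orthogonal projections $P$ ($P=P^t$, $P^2=P$, $\mathrm{Tr}P=s$), and carries the induced Zariski topology. Each point determines a sheaf $\mathcal{F}$ on $\Gamma$: $\mathcal{F}(v)=\mathbb{V}/S_v$, $\mathcal{F}(e)=\mathbb{V}/\ker(\alpha_e)$, with restriction maps the reductions $\mathbb{V}/S_v\to\mathbb{V}/\ker\alpha_e$ (well defined since $S_v\subseteq\ker\alpha_e$). Sheaf cohomology: for signs $[v:e]=-[u:e]$ on each edge $e=vu$, $d:\bigoplus_v\mathcal{F}(v)\to\bigoplus_e\mathcal{F}(e)$, $d(w)_e=\sum_{v\in e}[v:e]r^v_e(w_v)$, $H^0=\ker d$, $H^1=\operatorname{coker}d$. A multigraph is $(d,\ell)$-sparse if every $V'\subseteq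 V$ with $|V'|\geq 2$ spans at most $d|V'|-\ell$ edges (with multiplicity). *)

theory Defs
  imports "HOL-Analysis.Analysis" "HOL-Algebra.FiniteProduct" "HOL-Algebra.Product_Groups"
begin

section \<open>Multigraphs\<close>

text \<open>Edges are labels and \<open>ends e\<close> is the set of the two end vertices of \<open>e\<close>: parallel edges
  are allowed, loops are not (the sign rule \<open>[v:e] = -[u:e]\<close> for \<open>e = vu\<close> excludes them).\<close>

definition multigraph :: "'v set \<Rightarrow> 'e set \<Rightarrow> ('e \<Rightarrow> 'v set) \<Rightarrow> bool" where
  "multigraph V E ends \<longleftrightarrow>
     finite V \<and> finite E \<and> (\<forall>e\<in>E. ends e \<subseteq> V \<and> card (ends e) = 2)"

definition sparse_multigraph :: "nat \<Rightarrow> nat \<Rightarrow> 'v set \<Rightarrow> 'e set \<Rightarrow> ('e \<Rightarrow> 'v set) \<Rightarrow> bool" where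
  "sparse_multigraph d l V E ends \<longleftrightarrow>
     (\<forall>W\<subseteq>V. 2 \<le> card W \<longrightarrow>
        int (card {e\<in>E. ends e \<subseteq> W}) \<le> int d * int (card W) - int l)"

text \<open>A choice of incidence signs \<open>[v:e]\<close>.\<close>

definition incidence_signs :: "'e set \<Rightarrow> ('e \<Rightarrow> 'v set) \<Rightarrow> ('v \<Rightarrow> 'e \<Rightarrow> int) \<Rightarrow> bool" where
  "incidence_signs E ends sg \<longleftrightarrow>
     (\<forall>e\<in>E. (\<forall>v\<in>ends e. sg v e \<in> {1, -1}) \<and>
        (\<forall>u\<in>ends e. \<forall>v\<in>ends e. u \<noteq> v \<longrightarrow> sg v e = - sg u e))"


section \<open>Zariski topology\<close>

text \<open>The real algebra of functions generated by a set \<open>C\<close> of coordinate functions, i.e. the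
  polynomials in finitely many of the coordinates.\<close>

inductive_set polynomial_functions :: "('x \<Rightarrow> real) set \<Rightarrow> ('x \<Rightarrow> real) set"
  for C :: "('x \<Rightarrow> real) set" where
  const: "(\<lambda>_. c) \<in> polynomial_functions C"
| coord: "f \<in> C \<Longrightarrow> f \<in> polynomial_functions C"
| add: "\<lbrakk>f \<in> polynomial_functions C; g \<in> polynomial_functions C\<rbrakk>
          \<Longrightarrow> (\<lambda>x. f x + g x) \<in> polynomial_functions C"
| mult: "\<lbrakk>f \<in> polynomial_functions C; g \<in> polynomial_functions C\<rbrakk>
          \<Longrightarrow> (\<lambda>x. f x * g x) \<in> polynomial_functions C"

definition zero_locus :: "('x \<Rightarrow> real) set \<Rightarrow> 'x set" where
  "zero_locus F = {x. \<forall>f\<in>F. f x = 0}"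

definition zariski_open :: "('x \<Rightarrow> real) set \<Rightarrow> 'x set \<Rightarrow> bool" where
  "zariski_open C U \<longleftrightarrow> (\<exists>F \<subseteq> polynomial_functions C. U = - zero_locus F)"

definition zariski :: "('x \<Rightarrow> real) set \<Rightarrow> 'x topology" where
  "zariski C = topology (zariski_open C)"

lemma istopology_zariski_open: "istopology (zariski_open C)"
  unfolding istopology_def
proof (intro conjI allI impI)
  fix S T assume "zariski_open C S" "zariski_open C T"
  then obtain F G where F: "F \<subseteq> polynomial_functions C" "S = - zero_locus F"
    and G: "G \<subseteq> polynomial_functions C" "T = - zero_locus G"
    unfolding zariski_open_def by blast
  let ?H = "{(\<lambda>x. f x * g x) | f g. f \<in> F \<and> g \<in> G}"
  have "?H \<subseteq> polynomial_functions C"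
    using F(1) G(1) by (auto intro: polynomial_functions.mult)
  moreover have "S \<inter> T = - zero_locus ?H"
    unfolding F(2) G(2) zero_locus_def by fastforce
  ultimately show "zariski_open C (S \<inter> T)"
    unfolding zariski_open_def by blast
next
  fix K assume "\<forall>S\<in>K. zariski_open C S"
  then obtain F where F: "\<And>S. S \<in> K \<Longrightarrow> F S \<subseteq> polynomial_functions C \<and> S = - zero_locus (F S)"
    unfolding zariski_open_def by metis
  have "\<Union>K = - zero_locus (\<Union>S\<in>K. F S)"
  proof (intro Set.set_eqI iffI)
    fix x assume "x \<in> \<Union>K"
    then obtain S where S: "S \<in> K" "x \<in> S" by blast
    then have "x \<in> - zero_locus (F S)" using F by blast
    then show "x \<in> - zero_locus (\<Union>S\<in>K. F S)" using S(1) unfolding zero_locus_def by auto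
  next
    fix x assume "x \<in> - zero_locus (\<Union>S\<in>K. F S)"
    then obtain S f where "S \<in> K" "f \<in> F S" "f x \<noteq> 0" unfolding zero_locus_def by auto
    then have "x \<in> - zero_locus (F S)" unfolding zero_locus_def by auto
    then show "x \<in> \<Union>K" using F \<open>S \<in> K\<close> by blast
  qed
  moreover have "(\<Union>S\<in>K. F S) \<subseteq> polynomial_functions C" using F by blast
  ultimately show "zariski_open C (\<Union>K)" unfolding zariski_open_def by blast
qed

lemma openin_zariski: "openin (zariski C) U \<longleftrightarrow> zariski_open C U"
  unfolding zariski_def using istopology_zariski_open[of C] by (simp add: topology_inverse')


section \<open>The parameter space\<close>

definition grassmannian :: "nat \<Rightarrow> (real^'n^'n) set" where
  "grassmannian s = {P. transpose P = P \<and> P ** P = P \<and> trace P = real s}"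

text \<open>The subspace represented by an orthogonal projection.\<close>

definition subspace_of :: "real^'n^'n \<Rightarrow> (real^'n) set" where
  "subspace_of P = range (\<lambda>x. P *v x)"

definition kern :: "((real^'n) \<Rightarrow>\<^sub>L real) \<Rightarrow> (real^'n) set" where
  "kern a = {x. blinfun_apply a x = 0}"

text \<open>The dual space of \<open>real^'n\<close> is the type of bounded linear maps to \<open>real\<close>
  (in finite dimension every linear functional is bounded). Tuples indexed by \<open>V\<close> and \<open>E\<close> are
  functions that are \<open>undefined\<close> outside \<open>V\<close> and \<open>E\<close>.\<close>

type_synonym ('v, 'e, 'n) point =
  "('v \<Rightarrow> real^'n^'n) \<times> ('e \<Rightarrow> (real^'n) \<Rightarrow>\<^sub>L real)"

definition Z_set :: "nat \<Rightarrow> 'v set \<Rightarrow> 'e set \<Rightarrow> ('e \<Rightarrow> 'v set) \<Rightarrow> ('v, 'e, 'n::finite) point set" where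
  "Z_set s V E ends =
     {(P, a). P \<in> V \<rightarrow>\<^sub>E grassmannian s \<and> a \<in> E \<rightarrow>\<^sub>E UNIV \<and>
        (\<forall>e\<in>E. \<forall>v\<in>ends e. \<forall>x\<in>subspace_of (P v). blinfun_apply (a e) x = 0) \<and>
        (\<forall>u\<in>V. \<forall>v\<in>V. u \<noteq> v \<longrightarrow> subspace_of (P u) \<inter> subspace_of (P v) = {0})}"

text \<open>The matrix entries of the projections and the coefficients of the functionals.\<close>

definition coordinates :: "'v set \<Rightarrow> 'e set \<Rightarrow> (('v, 'e, 'n::finite) point \<Rightarrow> real) set" where
  "coordinates V E =
     {(\<lambda>p. fst p v $ i $ j) | v i j. v \<in> V} \<union>
     {(\<lambda>p. blinfun_apply (snd p e) (axis i 1)) | e i. e \<in> E}"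

definition Z_space :: "nat \<Rightarrow> 'v set \<Rightarrow> 'e set \<Rightarrow> ('e \<Rightarrow> 'v set) \<Rightarrow> ('v, 'e, 'n::finite) point topology" where
  "Z_space s V E ends = subtopology (zariski (coordinates V E)) (Z_set s V E ends)"


section \<open>Sheaves on a multigraph and their cohomology\<close>

text \<open>Stalks are recorded as multiplicatively written HOL-Algebra groups: only the additive groups
  underlying the stalks are needed to form the coboundary map and its cokernel, and hence
  to say that a cohomology space is zero.\<close>

record ('v, 'e, 'a, 'b) graph_sheaf =
  vstalk :: "'v \<Rightarrow> 'a monoid"
  estalk :: "'e \<Rightarrow> 'b monoid"
  restr :: "'v \<Rightarrow> 'e \<Rightarrow> 'a \<Rightarrow> 'b"

text \<open>As \<open>V\<close> and \<open>E\<close> are finite, the direct sums are products.\<close>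

definition C0 :: "'v set \<Rightarrow> ('v, 'e, 'a, 'b) graph_sheaf \<Rightarrow> ('v \<Rightarrow> 'a) monoid" where
  "C0 V F = product_group V (vstalk F)"

definition C1 :: "'e set \<Rightarrow> ('v, 'e, 'a, 'b) graph_sheaf \<Rightarrow> ('e \<Rightarrow> 'b) monoid" where
  "C1 E F = product_group E (estalk F)"

definition coboundary ::
  "'e set \<Rightarrow> ('e \<Rightarrow> 'v set) \<Rightarrow> ('v \<Rightarrow> 'e \<Rightarrow> int) \<Rightarrow> ('v, 'e, 'a, 'b) graph_sheaf \<Rightarrow>
     ('v \<Rightarrow> 'a) \<Rightarrow> ('e \<Rightarrow> 'b)" where
  "coboundary E ends sg F w =
     (\<lambda>e\<in>E. finprod (estalk F e) (\<lambda>v. restr F v e (w v) [^]\<^bsub>estalk F e\<^esub> sg v e) (ends e))"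

definition H1 ::
  "'v set \<Rightarrow> 'e set \<Rightarrow> ('e \<Rightarrow> 'v set) \<Rightarrow> ('v \<Rightarrow> 'e \<Rightarrow> int) \<Rightarrow> ('v, 'e, 'a, 'b) graph_sheaf \<Rightarrow>
     ('e \<Rightarrow> 'b) set monoid" where
  "H1 V E ends sg F = C1 E F Mod (coboundary E ends sg F ` carrier (C0 V F))"


section \<open>The sheaf determined by a point\<close>

definition additive_group :: "'a::ab_group_add monoid" where
  "additive_group = \<lparr>carrier = UNIV, mult = (+), one = 0\<rparr>"

text \<open>For \<open>S \<subseteq> ker a\<close> the reduction \<open>x + S \<mapsto> x + ker a\<close> sends a coset \<open>X\<close> to \<open>ker a + X\<close>;
  see \<open>reduction_coset\<close> below.\<close>

definition sheaf_of ::
  "('v, 'e, 'n::finite) point \<Rightarrow> ('v, 'e, (real^'n) set, (real^'n) set) graph_sheaf" where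
  "sheaf_of p =
     \<lparr>vstalk = (\<lambda>v. additive_group Mod subspace_of (fst p v)),
      estalk = (\<lambda>e. additive_group Mod kern (snd p e)),
      restr = (\<lambda>v e X. kern (snd p e) <#>\<^bsub>additive_group\<^esub> X)\<rparr>"

lemma comm_group_additive: "comm_group (additive_group :: 'a::ab_group_add monoid)"
proof (rule comm_groupI)
  fix x :: 'a
  show "\<exists>y\<in>carrier additive_group. y \<otimes>\<^bsub>additive_group\<^esub> x = \<one>\<^bsub>additive_group\<^esub>"
    by (intro bexI[of _ "- x"]) (simp_all add: additive_group_def)
qed (simp_all add: additive_group_def add.assoc add.commute)

lemma inv_additive: "inv\<^bsub>additive_group\<^esub> (x::'a::ab_group_add) = - x"
proof -
  interpret comm_group "additive_group :: 'a monoid" by (rule comm_group_additive)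
  show ?thesis by (rule inv_equality) (auto simp: additive_group_def)
qed

lemma subgroup_additive: "subspace S \<Longrightarrow> subgroup S (additive_group :: 'a::real_vector monoid)"
  by unfold_locales
     (auto simp: inv_additive subspace_neg,
      auto simp: additive_group_def subspace_add subspace_0)

lemma subspace_subspace_of: "subspace (subspace_of P)"
  unfolding subspace_of_def
  by (metis linear_subspace_image matrix_vector_mul_linear subspace_UNIV)

lemma subspace_kern: "subspace (kern a)"
  unfolding kern_def subspace_def
  by (auto simp: blinfun.add_right blinfun.scaleR_right)

lemma comm_group_quotient:
  "subspace S \<Longrightarrow> comm_group ((additive_group :: 'a::real_vector monoid) Mod S)"
  using comm_group.abelian_FactGroup[OF comm_group_additive subgroup_additive] .

lemma reduction_coset:
  assumes "subspace_of P \<subseteq> kern a"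
  shows "kern a <#>\<^bsub>additive_group\<^esub> (subspace_of P #>\<^bsub>additive_group\<^esub> x) = kern a #>\<^bsub>additive_group\<^esub> x"
proof -
  have 0: "0 \<in> subspace_of P" using subspace_subspace_of subspace_0 by blast
  have "kern a <#>\<^bsub>additive_group\<^esub> (subspace_of P #>\<^bsub>additive_group\<^esub> x) =
      {k + (s + x) | k s. k \<in> kern a \<and> s \<in> subspace_of P}"
    unfolding set_mult_def r_coset_def additive_group_def by auto
  also have "\<dots> = {k + x | k. k \<in> kern a}"
  proof (intro equalityI subsetI)
    fix y assume "y \<in> {k + (s + x) | k s. k \<in> kern a \<and> s \<in> subspace_of P}"
    then obtain k s where "k \<in> kern a" "s \<in> subspace_of P" and y: "y = k + (s + x)" by blast
    then have "k + s \<in> kern a" using assms subspace_add[OF subspace_kern] by blast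
    moreover have "y = (k + s) + x" using y by (simp add: add.assoc)
    ultimately show "y \<in> {k + x | k. k \<in> kern a}" by blast
  next
    fix y assume "y \<in> {k + x | k. k \<in> kern a}"
    then obtain k where "k \<in> kern a" "y = k + (0 + x)" by auto
    then show "y \<in> {k + (s + x) | k s. k \<in> kern a \<and> s \<in> subspace_of P}" using 0 by blast
  qed
  also have "\<dots> = kern a #>\<^bsub>additive_group\<^esub> x"
    unfolding r_coset_def additive_group_def by auto
  finally show ?thesis .
qed

end

theory Submission
  imports Defs "HOL-Library.Function_Algebras" "HOL-Computational_Algebra.Polynomial"
begin

text \<open>Put \<open>d = n - 1\<close>. By Rado's theorem, hyperplane normals \<open>a\<^sub>e \<in> \<real>\<^sup>d\<close> can be chosen on the edges of
  a \<open>(d,d)\<close>-sparse multigraph so that the map \<open>p \<mapsto> (a\<^sub>e \<cdot> (p\<^sub>u - p\<^sub>v))\<^sub>e\<close> on \<open>d\<close>-dimensional point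
  configurations is surjective. A \<open>(d,d+1)\<close>-sparse \<open>\<Gamma>\<close> stays \<open>(d,d)\<close>-sparse when any one edge \<open>uv\<close> is
  added; hence for generic \<open>a\<close> the kernel for \<open>\<Gamma>\<close> contains, for each pair \<open>u \<noteq> v\<close>, a configuration
  with \<open>p\<^sub>u \<noteq> p\<^sub>v\<close>, and so one configuration with all points distinct. In homogeneous coordinates this
  is a point of \<open>Z\<close>, at which the coboundary is surjective, and surjectivity is witnessed by a
  nonvanishing minor in the coefficients of the functionals.\<close>

section \<open>Rado's theorem for finite sets of vectors\<close>

context vector_space
begin

lemma card_independent_le_dim:
  assumes "finite X" "independent S" "S \<subseteq> span X"
  shows "card S \<le> dim X"
proof -
  obtain B where B: "B \<subseteq> X" "independent B" "X \<subseteq> span B" "card B = dim X"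
    using basis_exists by blast
  have "S \<subseteq> span B" using assms(3) B(3) by (metis span_mono span_span subset_trans)
  then show ?thesis
    using independent_span_bound[OF finite_subset[OF B(1) assms(1)] assms(2)] B(4) by simp
qed

text \<open>Submodularity of dimension. A basis \<open>S\<close> of \<open>C\<close> is extended to
  a basis \<open>T\<close> of \<open>A\<close> and further to a basis \<open>R\<close> of
  \<open>A \<union> B\<close>. The vectors of \<open>R\<close> outside \<open>T\<close> lie in
  \<open>B\<close> and stay independent together with \<open>S\<close>.\<close>

lemma dim_Un_le:
  assumes "finite A" "finite B" "C \<subseteq> A \<inter> B"
  shows "dim (A \<union> B) + dim C \<le> dim A + dim B"
proof -
  obtain S where S: "S \<subseteq> C" "independent S" "C \<subseteq> span S" "card S = dim C"
    using basis_exists by blast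
  obtain T where T: "S \<subseteq> T" "T \<subseteq> A" "independent T" "A \<subseteq> span T"
    using maximal_independent_subset_extend[of S A] S assms(3) by blast
  obtain R where R: "T \<subseteq> R" "R \<subseteq> A \<union> B" "independent R" "A \<union> B \<subseteq> span R"
    using maximal_independent_subset_extend[of T "A \<union> B"] T by blast
  have fin: "finite R" "finite T" "finite S"
    using R T assms finite_subset by (metis finite_UnI)+
  have dimA: "card T \<le> dim A"
    using card_independent_le_dim[OF assms(1) T(3)] T(2) span_superset by blast
  have dimAB: "dim (A \<union> B) \<le> card R"
    using dim_le_card[OF R(4) fin(1)] .
  \<comment> \<open>\<open>T\<close> already spans \<open>A\<close>, so a further vector of
    \<open>A\<close> would depend on the rest of \<open>R\<close>.\<close>
  have "(R - T) \<inter> A = {}"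
  proof (rule ccontr)
    assume "(R - T) \<inter> A \<noteq> {}"
    then obtain x where x: "x \<in> R" "x \<notin> T" "x \<in> A" by blast
    then have "x \<in> span (R - {x})"
      using T(4) R(1) span_mono[of T "R - {x}"] by blast
    then show False using R(3) x(1) unfolding dependent_def by blast
  qed
  then have sub: "S \<union> (R - T) \<subseteq> B" using R(2) S(1) assms(3) by blast
  have "independent (S \<union> (R - T))"
    using R(3) by (rule independent_mono) (use R(1) T(1) in blast)
  then have "card (S \<union> (R - T)) \<le> dim B"
    using card_independent_le_dim[OF assms(2)] sub span_superset by blast
  moreover have "card (S \<union> (R - T)) = card S + (card R - card T)"
    using fin T(1) R(1) by (subst card_Un_disjoint) (auto simp: card_Diff_subset)
  moreover have "card T \<le> card R" using card_mono[OF fin(1) R(1)] .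
  ultimately show ?thesis using dimA dimAB S(4) by linarith
qed

text \<open>The vector form of Hall's marriage theorem. As long as some \<open>A e\<close> has two
  elements, one of them can be deleted without losing the rank condition, by submodularity; once all
  sets are singletons, the condition for \<open>E\<close> itself gives independence.\<close>

theorem rado:
  assumes "finite E" "\<And>e. e \<in> E \<Longrightarrow> finite (A e)"
    and "\<And>F. F \<subseteq> E \<Longrightarrow> card F \<le> dim (\<Union>e\<in>F. A e)"
  shows "\<exists>x. (\<forall>e\<in>E. x e \<in> A e) \<and> inj_on x E \<and> independent (x ` E)"
  using assms(2-)
proof (induction "\<Sum>e\<in>E. card (A e)" arbitrary: A rule: less_induct)
  case (less A)
  note finA = less.prems(1) and hall = less.prems(2)
  have ne: "A e \<noteq> {}" if "e \<in> E" for e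
  proof
    assume "A e = {}"
    then show False using hall[of "{e}"] that dim_le_card[of "{}" "{}"] by simp
  qed
  show ?case
  proof (cases "\<forall>e\<in>E. card (A e) = 1")
    case True
    then have "\<forall>e\<in>E. \<exists>y. A e = {y}" by (simp add: card_1_singleton_iff)
    then obtain x where x: "\<And>e. e \<in> E \<Longrightarrow> A e = {x e}" by metis
    have fin: "finite (x ` E)" using assms(1) by simp
    have "(\<Union>e\<in>E. A e) = x ` E" using x by auto
    \<comment> \<open>This forces equality between the dimension, the size of the image and
      \<open>card E\<close>, so \<open>x\<close> is injective and its image is its own
      basis.\<close>
    then have le: "card E \<le> dim (x ` E)" using hall[of E] by simp
    obtain B where B: "B \<subseteq> x ` E" "independent B" "card B = dim (x ` E)"
      using basis_exists[of "x ` E"] by metis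
    have "card B \<le> card (x ` E)" "card (x ` E) \<le> card E"
      using card_mono[OF fin B(1)] card_image_le[OF assms(1)] by auto
    then have eq: "card (x ` E) = card E" "card B = card (x ` E)"
      using B(3) le by auto
    then have "inj_on x E" "B = x ` E"
      using eq_card_imp_inj_on[OF assms(1)] card_subset_eq[OF fin B(1)] by auto
    then show ?thesis using B(2) x by auto
  next
    case False
    then obtain a where a: "a \<in> E" "card (A a) \<noteq> 1" by blast
    then have "\<not> card (A a) \<le> Suc 0"
      using ne[OF a(1)] finA[OF a(1)] by (metis One_nat_def card_gt_0_iff le_antisym Suc_leI)
    then obtain y z where yz: "y \<in> A a" "z \<in> A a" "y \<noteq> z"
      using card_le_Suc0_iff_eq[OF finA[OF a(1)]] by blast
    define D where "D y = A(a := A a - {y})" for y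
    have step: ?thesis if y: "y \<in> A a" and H: "\<And>F. F \<subseteq> E \<Longrightarrow> card F \<le> dim (\<Union>e\<in>F. D y e)" for y
    proof -
      have "(\<Sum>e\<in>E. card (D y e)) < (\<Sum>e\<in>E. card (A e))"
      proof (rule sum_strict_mono_ex1[OF assms(1)])
        show "\<forall>e\<in>E. card (D y e) \<le> card (A e)"
          using finA by (auto simp: D_def intro: card_mono)
        show "\<exists>e\<in>E. card (D y e) < card (A e)"
          using card_Diff1_less[OF finA[OF a(1)] y] a(1) by (intro bexI[of _ a]) (simp_all add: D_def)
      qed
      then have "\<exists>x. (\<forall>e\<in>E. x e \<in> D y e) \<and> inj_on x E \<and> independent (x ` E)"
        using finA H by (intro less.hyps) (auto simp: D_def)
      moreover have "D y e \<subseteq> A e" for e by (auto simp: D_def)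
      ultimately show ?thesis by blast
    qed
    \<comment> \<open>Only \<open>A a\<close> has changed, so a set violating the condition after
      the deletion contains \<open>a\<close>. Splitting off \<open>a\<close> lowers its cardinality
      by one, which turns the strict inequality into \<open>\<le>\<close>.\<close>
    have viol: "\<exists>F\<subseteq>E - {a}. dim ((A a - {y}) \<union> (\<Union>e\<in>F. A e)) \<le> card F"
      if "F0 \<subseteq> E" "\<not> card F0 \<le> dim (\<Union>e\<in>F0. D y e)" for y F0
    proof -
      have "a \<in> F0"
      proof (rule ccontr)
        assume "a \<notin> F0"
        then have "(\<Union>e\<in>F0. D y e) = (\<Union>e\<in>F0. A e)" by (auto simp: D_def)
        then show False using that hall by simp
      qed
      then have "(\<Union>e\<in>F0. D y e) = (A a - {y}) \<union> (\<Union>e\<in>F0 - {a}. A e)"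
        by (auto simp: D_def split: if_splits)
      moreover have "card F0 = Suc (card (F0 - {a}))"
        using \<open>a \<in> F0\<close> that(1) assms(1) finite_subset by (metis card_Suc_Diff1)
      ultimately show ?thesis using that by (intro exI[of _ "F0 - {a}"]) auto
    qed
    show ?thesis
    proof (rule ccontr)
      assume no: "\<not> ?thesis"
      obtain F where F: "F \<subseteq> E - {a}" "dim ((A a - {y}) \<union> (\<Union>e\<in>F. A e)) \<le> card F"
        using step[OF yz(1)] viol no by metis
      obtain G where G: "G \<subseteq> E - {a}" "dim ((A a - {z}) \<union> (\<Union>e\<in>G. A e)) \<le> card G"
        using step[OF yz(2)] viol no by metis
      \<comment> \<open>As \<open>y \<noteq> z\<close>, the two reduced copies of \<open>A a\<close>
        cover \<open>A a\<close>. Submodularity and the original condition for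
        \<open>insert a (F \<union> G)\<close> and \<open>F \<inter> G\<close> then give
        \<open>card F + card G + 1 \<le> card F + card G\<close>.\<close>
      let ?X = "(A a - {y}) \<union> (\<Union>e\<in>F. A e)" and ?Y = "(A a - {z}) \<union> (\<Union>e\<in>G. A e)"
      have fFG: "finite F" "finite G" using F G assms(1) finite_subset by blast+
      have "finite ?X" "finite ?Y" using F G a(1) finA fFG by auto
      then have "dim (?X \<union> ?Y) + dim (\<Union>e\<in>F \<inter> G. A e) \<le> dim ?X + dim ?Y"
        by (rule dim_Un_le) blast
      moreover have "?X \<union> ?Y = (\<Union>e\<in>insert a (F \<union> G). A e)" using yz by blast
      moreover have "card (insert a (F \<union> G)) \<le> dim (\<Union>e\<in>insert a (F \<union> G). A e)"
        by (rule hall) (use F G a in blast)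
      moreover have "card (F \<inter> G) \<le> dim (\<Union>e\<in>F \<inter> G. A e)"
        by (rule hall) (use F in blast)
      moreover have "card (insert a (F \<union> G)) = Suc (card (F \<union> G))"
        using F G fFG by (subst card_insert_disjoint) auto
      moreover have "card (F \<union> G) + card (F \<inter> G) = card F + card G"
        using card_Un_Int[OF fFG] by simp
      ultimately show False using F(2) G(2) by simp
    qed
  qed
qed

end

section \<open>Linear algebra of real-valued functions on an index type\<close>

definition fscale :: "real \<Rightarrow> ('k \<Rightarrow> real) \<Rightarrow> 'k \<Rightarrow> real" where
  "fscale c f = (\<lambda>k. c * f k)"

interpretation fvs: vector_space "fscale :: real \<Rightarrow> ('k \<Rightarrow> real) \<Rightarrow> _"
  by unfold_locales (auto simp: fscale_def fun_eq_iff algebra_simps)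

interpretation fvs: vector_space_pair "fscale :: real \<Rightarrow> ('k \<Rightarrow> real) \<Rightarrow> _" "(*) :: real \<Rightarrow> real \<Rightarrow> real"
  by unfold_locales (auto simp: algebra_simps)

definition unit_fun :: "'k \<Rightarrow> 'k \<Rightarrow> real" where
  "unit_fun k = (\<lambda>j. if j = k then 1 else 0)"

lemma sum_fun_apply: "(\<Sum>a\<in>A. (f a :: 'k \<Rightarrow> real)) k = (\<Sum>a\<in>A. f a k)"
  by (induction A rule: infinite_finite_induct) auto

text \<open>Some linear functional takes prescribed values on independent vectors. Since the vectors
  are supported on the finite set \<open>K\<close>, the functional acts on them through its values
  on the unit functions, and these values form \<open>p\<close>.\<close>

lemma independent_dual_system:
  fixes x :: "'e \<Rightarrow> 'k \<Rightarrow> real"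
  assumes "finite K" "\<And>e k. e \<in> E \<Longrightarrow> k \<notin> K \<Longrightarrow> x e k = 0"
    and "inj_on x E" "fvs.independent (x ` E)"
  shows "\<exists>p. \<forall>e\<in>E. (\<Sum>k\<in>K. x e k * p k) = y e"
proof -
  \<comment> \<open>Injectivity of \<open>x\<close> makes it consistent to prescribe
    \<open>y e\<close> at \<open>x e\<close>.\<close>
  obtain g where lin: "Vector_Spaces.linear fscale (*) g"
    and g: "\<forall>z\<in>x ` E. g z = (y \<circ> inv_into E x) z"
    using fvs.linear_independent_extend[OF assms(4)] by blast
  interpret g: Vector_Spaces.linear fscale "(*)" g by (rule lin)
  have "(\<Sum>k\<in>K. x e k * g (unit_fun k)) = y e" if e: "e \<in> E" for e
  proof -
    have "x e = (\<Sum>k\<in>K. fscale (x e k) (unit_fun k))"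
    proof
      fix j
      have "(\<Sum>k\<in>K. x e k * unit_fun k j) = (\<Sum>k\<in>K. if j = k then x e k else 0)"
        by (rule sum.cong) (auto simp: unit_fun_def)
      then show "x e j = (\<Sum>k\<in>K. fscale (x e k) (unit_fun k)) j"
        using assms(1) assms(2)[OF e, of j] by (simp add: sum_fun_apply fscale_def)
    qed
    then have "g (x e) = (\<Sum>k\<in>K. x e k * g (unit_fun k))"
      by (metis (no_types, lifting) g.scale g.sum sum.cong)
    then show ?thesis using g e assms(3) by simp
  qed
  then show ?thesis by (intro exI ballI)
qed

text \<open>The values at the points of \<open>S\<close> form an identity matrix, so evaluating a
  linear relation at \<open>j\<close> isolates the coefficient of \<open>x j\<close>.\<close>

lemma independent_if_evaluation:
  fixes x :: "'k \<Rightarrow> 'k \<Rightarrow> real"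
  assumes "finite S" and 1: "\<And>k. k \<in> S \<Longrightarrow> x k k = 1"
    and 0: "\<And>j k. j \<in> S \<Longrightarrow> k \<in> S \<Longrightarrow> j \<noteq> k \<Longrightarrow> x k j = 0"
  shows "inj_on x S \<and> fvs.independent (x ` S)"
proof
  show inj: "inj_on x S"
    by (rule inj_onI) (metis 0 1 zero_neq_one)
  show "fvs.independent (x ` S)"
  proof (rule fvs.independent_if_scalars_zero)
    fix f z assume sum0: "(\<Sum>z\<in>x ` S. fscale (f z) z) = 0" and "z \<in> x ` S"
    then obtain j where j: "j \<in> S" "z = x j" by blast
    have "0 = (\<Sum>k\<in>S. fscale (f (x k)) (x k)) j"
      using sum0 inj by (simp add: sum.reindex)
    also have "\<dots> = (\<Sum>k\<in>S. f (x k) * x k j)"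
      by (simp add: sum_fun_apply fscale_def)
    also have "\<dots> = (\<Sum>k\<in>S. if k = j then f (x k) else 0)"
      by (rule sum.cong) (use 0 1 j in auto)
    also have "\<dots> = f z" using assms(1) j by simp
    finally show "f z = 0" by simp
  qed (use assms in simp)
qed

section \<open>Normals on a sparse multigraph\<close>

text \<open>The kernel of the map in question consists of the configurations in which, for each edge
  \<open>e\<close>, both end points lie on a common hyperplane with normal \<open>a e\<close> (for
  nonzero \<open>a e\<close>).\<close>

definition edge_surjective ::
  "'e set \<Rightarrow> ('e \<Rightarrow> 'v) \<Rightarrow> ('e \<Rightarrow> 'v) \<Rightarrow> 'i set \<Rightarrow> ('e \<Rightarrow> 'i \<Rightarrow> real) \<Rightarrow> bool" where
  "edge_surjective E src tgt I a \<longleftrightarrow>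
     (\<forall>y. \<exists>p. \<forall>e\<in>E. (\<Sum>i\<in>I. a e i * (p (src e) i - p (tgt e) i)) = y e)"

text \<open>The coefficient vector of the functional taking a configuration \<open>p\<close> to
  \<open>p u i - p v i\<close>: the row of the edge map for an edge from \<open>u\<close> to
  \<open>v\<close> whose normal is the unit vector in direction \<open>i\<close>.\<close>

definition edge_vec :: "'v \<Rightarrow> 'v \<Rightarrow> 'i \<Rightarrow> 'v \<times> 'i \<Rightarrow> real" where
  "edge_vec u v i = unit_fun (u, i) - unit_fun (v, i)"

lemma edge_vec_apply:
  "edge_vec u v i (w, j) = (if w = u \<and> j = i then 1 else 0) - (if w = v \<and> j = i then 1 else 0)"
  by (simp add: edge_vec_def unit_fun_def)

text \<open>This is Rado's condition for the rows available to each edge. Vertices are grouped by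
  which differences the span contains. A class of \<open>m\<close> vertices contributes
  \<open>card I * (m - 1)\<close> independent vectors to the span, and sparsity allows at most that
  many edges inside it.\<close>

lemma card_le_dim_edge_vecs:
  fixes src tgt :: "'e \<Rightarrow> 'v" and I :: "'i set"
  assumes fin: "finite V" "finite F" "finite I"
    and ends: "\<And>e. e \<in> F \<Longrightarrow> src e \<in> V \<and> tgt e \<in> V \<and> src e \<noteq> tgt e"
    and sparse: "\<And>W. W \<subseteq> V \<Longrightarrow> 2 \<le> card W \<Longrightarrow>
      card {e\<in>F. src e \<in> W \<and> tgt e \<in> W} + card I \<le> card I * card W"
  shows "card F \<le> fvs.dim (\<Union>e\<in>F. edge_vec (src e) (tgt e) ` I)"
proof -
  let ?X = "\<Union>e\<in>F. edge_vec (src e) (tgt e) ` I"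
  \<comment> \<open>An equivalence relation containing every edge of \<open>F\<close>; it takes the
    place of connectivity.\<close>
  define R where "R u v \<longleftrightarrow> (\<forall>i\<in>I. edge_vec u v i \<in> fvs.span ?X)" for u v
  have R_refl: "R u u" for u
    unfolding R_def edge_vec_def by (simp add: fvs.span_zero)
  have R_sym: "R u v" if "R v u" for u v
    unfolding R_def
  proof
    fix i assume "i \<in> I"
    then have "fscale (-1) (edge_vec v u i) \<in> fvs.span ?X"
      using that unfolding R_def by (blast intro: fvs.span_scale)
    moreover have "fscale (-1) (edge_vec v u i) = edge_vec u v i"
      by (auto simp: fscale_def edge_vec_def)
    ultimately show "edge_vec u v i \<in> fvs.span ?X" by simp
  qed
  have R_trans: "R u w" if "R u v" "R v w" for u v w
    unfolding R_def
  proof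
    fix i assume "i \<in> I"
    then have "edge_vec u v i + edge_vec v w i \<in> fvs.span ?X"
      using that unfolding R_def by (blast intro: fvs.span_add)
    moreover have "edge_vec u v i + edge_vec v w i = edge_vec u w i"
      by (auto simp: edge_vec_def)
    ultimately show "edge_vec u w i \<in> fvs.span ?X" by simp
  qed
  \<comment> \<open>The edges of \<open>F\<close> lie within the classes of \<open>R\<close>, so sparsity bounds their number by
    \<open>card I\<close> times the number of vertices other than the chosen representatives \<open>c v\<close>.\<close>
  define c where "c v = (SOME u. u \<in> V \<and> R v u)" for v
  have c: "c v \<in> V \<and> R v (c v)" if "v \<in> V" for v
    unfolding c_def by (rule someI[of _ v]) (use that R_refl in blast)
  have c_eq: "c u = c v" if "R u v" for u v
  proof -
    have "(\<lambda>x. x \<in> V \<and> R u x) = (\<lambda>x. x \<in> V \<and> R v x)"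
      using that R_sym R_trans by blast
    then show ?thesis unfolding c_def by simp
  qed
  have cc: "c (c v) = c v" if "v \<in> V" for v
    using c_eq[of "c v" v] c[OF that] R_sym by blast
  define N where "N = {v\<in>V. c v \<noteq> v}"
  define x where "x k = edge_vec (fst k) (c (fst k)) (snd k)" for k :: "'v \<times> 'i"
  have N_c: "c v \<notin> N" if "v \<in> V" for v
    using cc[OF that] unfolding N_def by blast
  \<comment> \<open>Representatives lie outside \<open>N\<close>, so the coordinates indexed by
    \<open>N \<times> I\<close> see only the first end of each \<open>x k\<close>, and the values
    there form an identity matrix.\<close>
  have indep: "inj_on x (N \<times> I) \<and> fvs.independent (x ` (N \<times> I))"
  proof (rule independent_if_evaluation)
    show "finite (N \<times> I)" using fin unfolding N_def by simp
    show "x k k = 1" if "k \<in> N \<times> I" for k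
      using that by (auto simp: x_def edge_vec_apply N_def)
    show "x k j = 0" if "j \<in> N \<times> I" "k \<in> N \<times> I" "j \<noteq> k" for j k
    proof -
      have "fst j \<noteq> c (fst k)" using that N_c[of "fst k"] by (auto simp: N_def)
      then show ?thesis using that by (cases j; cases k) (auto simp: x_def edge_vec_apply)
    qed
  qed
  have "x ` (N \<times> I) \<subseteq> fvs.span ?X"
    using c by (auto simp: x_def N_def R_def)
  then have "card (x ` (N \<times> I)) \<le> fvs.dim ?X"
    using indep fin by (intro fvs.card_independent_le_dim) auto
  then have dim: "card N * card I \<le> fvs.dim ?X"
    using indep by (simp add: card_image card_cartesian_product)
  define W where "W r = {v\<in>V. c v = r}" for r
  define FW where "FW r = {e\<in>F. src e \<in> W r \<and> tgt e \<in> W r}" for r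
  have finW: "finite (W r)" for r using fin by (simp add: W_def)
  have F_eq: "F = (\<Union>r\<in>c ` V. FW r)"
  proof
    show "F \<subseteq> (\<Union>r\<in>c ` V. FW r)"
    proof
      fix e assume e: "e \<in> F"
      then have "R (src e) (tgt e)"
        unfolding R_def by (blast intro: fvs.span_base)
      then have "c (src e) = c (tgt e)" by (rule c_eq)
      then show "e \<in> (\<Union>r\<in>c ` V. FW r)"
        using e ends[OF e] by (auto simp: FW_def W_def)
    qed
  qed (auto simp: FW_def)
  have FW_le: "card (FW r) + card I \<le> card I * card (W r)" if r: "r \<in> c ` V" for r
  proof (cases "2 \<le> card (W r)")
    case True
    have "W r \<subseteq> V" by (auto simp: W_def)
    then show ?thesis using sparse[OF _ True] unfolding FW_def by simp
  next
    \<comment> \<open>Sparsity says nothing about a single vertex; there the bound holds because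
      without loops no edge lies inside it.\<close>
    case False
    have "W r \<noteq> {}" using r by (auto simp: W_def)
    then have card1: "card (W r) = 1"
      using False finW[of r] card_gt_0_iff[of "W r"] by linarith
    then obtain w where "W r = {w}" by (auto simp: card_1_singleton_iff)
    then have "FW r = {}" using ends by (fastforce simp: FW_def)
    then show ?thesis using card1 by simp
  qed
  have V_eq: "V = (\<Union>r\<in>c ` V. W r)" by (auto simp: W_def)
  have "card V = (\<Sum>r\<in>c ` V. card (W r))"
    by (subst V_eq, rule card_UN_disjoint) (use fin finW in \<open>auto simp: W_def\<close>)
  moreover have "(\<Sum>r\<in>c ` V. card (FW r) + card I) \<le> (\<Sum>r\<in>c ` V. card I * card (W r))"
    by (rule sum_mono) (rule FW_le)
  ultimately have "(\<Sum>r\<in>c ` V. card (FW r)) + card (c ` V) * card I \<le> card I * card V"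
    by (simp add: sum.distrib sum_distrib_left)
  moreover have "card F \<le> (\<Sum>r\<in>c ` V. card (FW r))"
    by (subst F_eq, rule card_UN_le) (use fin in simp)
  moreover have "card V = card N + card (c ` V)"
  proof -
    have "N \<union> c ` V \<subseteq> V" using c by (auto simp: N_def)
    moreover have "v \<in> N \<union> c ` V" if "v \<in> V" for v
      using that image_eqI[of v c v V] by (cases "c v = v") (auto simp: N_def)
    ultimately have "V = N \<union> c ` V" by (intro equalityI subsetI) auto
    moreover have "N \<inter> c ` V = {}" using N_c by blast
    moreover have "finite N" using fin by (simp add: N_def)
    ultimately show ?thesis using fin card_Un_disjoint[of N "c ` V"] by simp
  qed
  ultimately have "card F \<le> card N * card I"
    by (simp add: algebra_simps)
  then show ?thesis using dim by linarith
qed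

text \<open>With \<open>d = card I\<close> the hypothesis is (d,d)-sparsity, written without
  subtraction. Rado's theorem selects a coordinate direction for each edge so that the resulting
  rows are independent, and a matrix with independent rows is surjective.\<close>

lemma edge_surjective_if_sparse:
  fixes src tgt :: "'e \<Rightarrow> 'v" and I :: "'i set"
  assumes fin: "finite V" "finite E" "finite I"
    and ends: "\<And>e. e \<in> E \<Longrightarrow> src e \<in> V \<and> tgt e \<in> V \<and> src e \<noteq> tgt e"
    and sparse: "\<And>W. W \<subseteq> V \<Longrightarrow> 2 \<le> card W \<Longrightarrow>
      card {e\<in>E. src e \<in> W \<and> tgt e \<in> W} + card I \<le> card I * card W"
  shows "\<exists>a. edge_surjective E src tgt I a"
proof -
  define A where "A e = edge_vec (src e) (tgt e) ` I" for e
  have "\<exists>x. (\<forall>e\<in>E. x e \<in> A e) \<and> inj_on x E \<and> fvs.independent (x ` E)"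
  proof (rule fvs.rado[OF fin(2)])
    show "finite (A e)" for e using fin by (simp add: A_def)
    show "card F \<le> fvs.dim (\<Union>e\<in>F. A e)" if F: "F \<subseteq> E" for F
      unfolding A_def
    proof (rule card_le_dim_edge_vecs[OF fin(1) _ fin(3)])
      show finF: "finite F" using F fin finite_subset by blast
      show "src e \<in> V \<and> tgt e \<in> V \<and> src e \<noteq> tgt e" if "e \<in> F" for e
        using ends that F by blast
      show "card {e\<in>F. src e \<in> W \<and> tgt e \<in> W} + card I \<le> card I * card W"
        if W: "W \<subseteq> V" "2 \<le> card W" for W
      proof -
        have "card {e\<in>F. src e \<in> W \<and> tgt e \<in> W} \<le> card {e\<in>E. src e \<in> W \<and> tgt e \<in> W}"
          using F fin by (intro card_mono) auto
        then show ?thesis using sparse[OF W] by linarith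
      qed
    qed
  qed
  then obtain x where x: "\<forall>e\<in>E. x e \<in> A e" "inj_on x E" "fvs.independent (x ` E)" by blast
  then have "\<forall>e\<in>E. \<exists>i\<in>I. x e = edge_vec (src e) (tgt e) i" by (auto simp: A_def)
  then obtain ix where ix: "\<And>e. e \<in> E \<Longrightarrow> ix e \<in> I \<and> x e = edge_vec (src e) (tgt e) (ix e)"
    by metis
  \<comment> \<open>The normal of \<open>e\<close> is the unit vector in the direction selected for
    \<open>e\<close>.\<close>
  define a :: "'e \<Rightarrow> 'i \<Rightarrow> real" where "a e i = (if i = ix e then 1 else 0)" for e i
  have "edge_surjective E src tgt I a"
    unfolding edge_surjective_def
  proof
    fix y :: "'e \<Rightarrow> real"
    have "\<exists>p. \<forall>e\<in>E. (\<Sum>k\<in>V \<times> I. x e k * p k) = y e"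
    proof (rule independent_dual_system[OF _ _ x(2,3)])
      show "finite (V \<times> I)" using fin by simp
      show "x e k = 0" if "e \<in> E" "k \<notin> V \<times> I" for e k
        using that ix[OF that(1)] ends[OF that(1)] by (cases k) (auto simp: edge_vec_apply)
    qed
    then obtain p where p: "\<And>e. e \<in> E \<Longrightarrow> (\<Sum>k\<in>V \<times> I. x e k * p k) = y e" by blast
    have "(\<Sum>i\<in>I. a e i * (p (src e, i) - p (tgt e, i))) = y e" if e: "e \<in> E" for e
    proof -
      have "(\<Sum>k\<in>V \<times> I. x e k * p k) =
          (\<Sum>k\<in>V \<times> I. (if k = (src e, ix e) then p k else 0) - (if k = (tgt e, ix e) then p k else 0))"
        by (rule sum.cong) (use ix[OF e] in \<open>auto simp: edge_vec_def unit_fun_def\<close>)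
      also have "\<dots> = p (src e, ix e) - p (tgt e, ix e)"
        using fin ends[OF e] ix[OF e] by (simp add: sum_subtractf)
      also have "\<dots> = (\<Sum>i\<in>I. if i = ix e then p (src e, i) - p (tgt e, i) else 0)"
        using fin ix[OF e] by simp
      also have "\<dots> = (\<Sum>i\<in>I. a e i * (p (src e, i) - p (tgt e, i)))"
        by (rule sum.cong) (auto simp: a_def)
      finally show ?thesis using p[OF e] by simp
    qed
    then show "\<exists>p. \<forall>e\<in>E. (\<Sum>i\<in>I. a e i * (p (src e) i - p (tgt e) i)) = y e"
      by (intro exI[of _ "\<lambda>v i. p (v, i)"] ballI)
  qed
  then show ?thesis by (rule exI[of _ a])
qed

section \<open>Genericity\<close>

lemma polynomial_functions_diff:
  assumes "f \<in> polynomial_functions C" "g \<in> polynomial_functions C"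
  shows "(\<lambda>x. f x - g x) \<in> polynomial_functions C"
proof -
  have "(\<lambda>x. f x + (-1) * g x) \<in> polynomial_functions C"
    by (intro polynomial_functions.add polynomial_functions.mult polynomial_functions.const assms)
  then show ?thesis by simp
qed

lemma polynomial_functions_sum:
  assumes "\<And>a. a \<in> A \<Longrightarrow> f a \<in> polynomial_functions C"
  shows "(\<lambda>x. \<Sum>a\<in>A. f a x) \<in> polynomial_functions C"
  using assms
proof (induction A rule: infinite_finite_induct)
  case (insert a A)
  then have "(\<lambda>x. f a x + (\<Sum>a\<in>A. f a x)) \<in> polynomial_functions C"
    by (intro polynomial_functions.add) auto
  then show ?case using insert by simp
qed (auto intro: polynomial_functions.const)

text \<open>Fraction-free Gaussian elimination: \<open>f\<close> is the product of the pivots.\<close>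

lemma matrix_surjective_zariski_open:
  fixes m :: "'e \<Rightarrow> 'e \<Rightarrow> 'x \<Rightarrow> real"
  assumes "finite E"
    and "\<And>e e'. e \<in> E \<Longrightarrow> e' \<in> E \<Longrightarrow> m e e' \<in> polynomial_functions C"
    and "\<And>e e'. e \<in> E \<Longrightarrow> e' \<in> E \<Longrightarrow> m e e' x0 = (if e = e' then 1 else 0)"
  shows "\<exists>f\<in>polynomial_functions C. f x0 \<noteq> 0 \<and>
           (\<forall>x. f x \<noteq> 0 \<longrightarrow> (\<forall>y. \<exists>c. \<forall>e\<in>E. (\<Sum>e'\<in>E. m e e' x * c e') = y e))"
  using assms
proof (induction E arbitrary: m rule: finite_induct)
  case empty
  show ?case by (rule bexI[of _ "\<lambda>_. 1"]) (auto intro: polynomial_functions.const)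
next
  case (insert q E)
  note poly = insert.prems(1) and id = insert.prems(2)
  \<comment> \<open>The Schur complement of the pivot \<open>m q q\<close>, multiplied by the pivot
    to remain polynomial. At \<open>x0\<close> it is again the identity.\<close>
  define m' where "m' e e' x = m q q x * m e e' x - m e q x * m q e' x" for e e' x
  have "\<exists>f\<in>polynomial_functions C. f x0 \<noteq> 0 \<and>
           (\<forall>x. f x \<noteq> 0 \<longrightarrow> (\<forall>y. \<exists>c. \<forall>e\<in>E. (\<Sum>e'\<in>E. m' e e' x * c e') = y e))"
  proof (rule insert.IH)
    show "m' e e' \<in> polynomial_functions C" if "e \<in> E" "e' \<in> E" for e e'
      unfolding m'_def using that
      by (intro polynomial_functions_diff polynomial_functions.mult poly) auto
    show "m' e e' x0 = (if e = e' then 1 else 0)" if "e \<in> E" "e' \<in> E" for e e'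
      using that insert.hyps id by (auto simp: m'_def)
  qed
  then obtain f where f: "f \<in> polynomial_functions C" "f x0 \<noteq> 0"
    and surj: "\<And>x y. f x \<noteq> 0 \<Longrightarrow> \<exists>c. \<forall>e\<in>E. (\<Sum>e'\<in>E. m' e e' x * c e') = y e"
    by blast
  show ?case
  proof (intro bexI conjI allI impI)
    show "(\<lambda>x. m q q x * f x) \<in> polynomial_functions C"
      by (intro polynomial_functions.mult poly f) auto
    show "m q q x0 * f x0 \<noteq> 0" using f id by simp
    fix x y assume "m q q x * f x \<noteq> 0"
    then have nz: "m q q x \<noteq> 0" "f x \<noteq> 0" by auto
    obtain c where c: "\<And>e. e \<in> E \<Longrightarrow>
        (\<Sum>e'\<in>E. m' e e' x * c e') = m q q x * y e - m e q x * y q"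
      using surj[OF nz(2), of "\<lambda>e. m q q x * y e - m e q x * y q"] by blast
    \<comment> \<open>Back substitution: row \<open>q\<close> determines the unknown at
      \<open>q\<close> from the others.\<close>
    define s where "s = (\<Sum>e'\<in>E. m q e' x * c e')"
    define c' where "c' = c(q := (y q - s) / m q q x)"
    have c'_sum: "(\<Sum>e'\<in>insert q E. m e e' x * c' e') =
        m e q x * ((y q - s) / m q q x) + (\<Sum>e'\<in>E. m e e' x * c e')" for e
      using insert.hyps by (auto simp: c'_def intro!: sum.cong)
    have "(\<Sum>e'\<in>insert q E. m e e' x * c' e') = y e" if "e \<in> insert q E" for e
    proof (cases "e = q")
      case True
      then show ?thesis using c'_sum[of q] nz by (simp add: s_def)
    next
      case False
      then have e: "e \<in> E" using that by simp
      have "(\<Sum>e'\<in>E. m' e e' x * c e') = m q q x * (\<Sum>e'\<in>E. m e e' x * c e') - m e q x * s"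
        by (simp add: m'_def s_def sum_subtractf sum_distrib_left algebra_simps)
      then have "m q q x * (\<Sum>e'\<in>E. m e e' x * c e') = m q q x * y e - m e q x * (y q - s)"
        using c[OF e] by (simp add: algebra_simps)
      then have "(\<Sum>e'\<in>E. m e e' x * c e') = y e - m e q x * ((y q - s) / m q q x)"
        using nz by (simp add: field_simps)
      then show ?thesis using c'_sum[of e] by simp
    qed
    then show "\<exists>c. \<forall>e\<in>insert q E. (\<Sum>e'\<in>insert q E. m e e' x * c e') = y e"
      by (intro exI[of _ c'] ballI)
  qed
qed

text \<open>Surjectivity at \<open>x0\<close> provides configurations \<open>p e'\<close> mapped to
  the standard basis vectors. With these fixed, their images at a varying \<open>x\<close> form a
  square polynomial matrix \<open>m\<close> that is the identity at \<open>x0\<close>; wherever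
  \<open>m\<close> is surjective, combinations of the \<open>p e'\<close> reach every
  target.\<close>

lemma edge_surjective_zariski_open:
  fixes a :: "'e \<Rightarrow> 'i \<Rightarrow> 'x \<Rightarrow> real"
  assumes "finite E"
    and poly: "\<And>e i. e \<in> E \<Longrightarrow> i \<in> I \<Longrightarrow> a e i \<in> polynomial_functions C"
    and surj: "edge_surjective E src tgt I (\<lambda>e i. a e i x0)"
  shows "\<exists>f\<in>polynomial_functions C. f x0 \<noteq> 0 \<and>
           (\<forall>x. f x \<noteq> 0 \<longrightarrow> edge_surjective E src tgt I (\<lambda>e i. a e i x))"
proof -
  have "\<forall>e'. \<exists>p. \<forall>e\<in>E. (\<Sum>i\<in>I. a e i x0 * (p (src e) i - p (tgt e) i)) = (if e = e' then 1 else 0)"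
  proof
    fix e'
    show "\<exists>p. \<forall>e\<in>E. (\<Sum>i\<in>I. a e i x0 * (p (src e) i - p (tgt e) i)) = (if e = e' then 1 else 0)"
      by (rule surj[unfolded edge_surjective_def, rule_format])
  qed
  then obtain p where p: "\<And>e e'. e \<in> E \<Longrightarrow>
      (\<Sum>i\<in>I. a e i x0 * (p e' (src e) i - p e' (tgt e) i)) = (if e = e' then 1 else 0)"
    by metis
  define m where "m e e' x = (\<Sum>i\<in>I. a e i x * (p e' (src e) i - p e' (tgt e) i))" for e e' x
  have "\<exists>f\<in>polynomial_functions C. f x0 \<noteq> 0 \<and>
           (\<forall>x. f x \<noteq> 0 \<longrightarrow> (\<forall>y. \<exists>c. \<forall>e\<in>E. (\<Sum>e'\<in>E. m e e' x * c e') = y e))"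
  proof (rule matrix_surjective_zariski_open[OF assms(1)])
    show "m e e' \<in> polynomial_functions C" if "e \<in> E" "e' \<in> E" for e e'
      unfolding m_def using that
      by (intro polynomial_functions_sum polynomial_functions.mult polynomial_functions.const poly)
    show "m e e' x0 = (if e = e' then 1 else 0)" if "e \<in> E" "e' \<in> E" for e e'
      using p[OF that(1)] by (simp add: m_def)
  qed
  then obtain f where f: "f \<in> polynomial_functions C" "f x0 \<noteq> 0"
    and f_surj: "\<And>x y. f x \<noteq> 0 \<Longrightarrow> \<exists>c. \<forall>e\<in>E. (\<Sum>e'\<in>E. m e e' x * c e') = y e"
    by blast
  have "edge_surjective E src tgt I (\<lambda>e i. a e i x)" if x: "f x \<noteq> 0" for x
    unfolding edge_surjective_def
  proof
    fix y
    obtain c where c: "\<And>e. e \<in> E \<Longrightarrow> (\<Sum>e'\<in>E. m e e' x * c e') = y e"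
      using f_surj[OF x] by blast
    define w where "w v i = (\<Sum>e'\<in>E. c e' * p e' v i)" for v i
    have "(\<Sum>i\<in>I. a e i x * (w (src e) i - w (tgt e) i)) = (\<Sum>e'\<in>E. m e e' x * c e')" for e
    proof -
      have "(\<Sum>i\<in>I. a e i x * (w (src e) i - w (tgt e) i)) =
          (\<Sum>i\<in>I. \<Sum>e'\<in>E. a e i x * (p e' (src e) i - p e' (tgt e) i) * c e')"
        by (simp add: w_def sum_distrib_left algebra_simps flip: sum_subtractf)
      also have "\<dots> = (\<Sum>e'\<in>E. m e e' x * c e')"
        by (subst sum.swap) (simp add: m_def sum_distrib_right)
      finally show ?thesis .
    qed
    then show "\<exists>w. \<forall>e\<in>E. (\<Sum>i\<in>I. a e i x * (w (src e) i - w (tgt e) i)) = y e"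
      using c by (intro exI[of _ w] ballI) simp
  qed
  then show ?thesis using f by (intro bexI[of _ f]) auto
qed

section \<open>Common nonzeros of polynomials on an affine space\<close>

definition evaluations :: "(('k \<Rightarrow> real) \<Rightarrow> real) set" where
  "evaluations = range (\<lambda>k x. x k)"

lemma polynomial_functions_on_line:
  assumes "f \<in> polynomial_functions evaluations"
  shows "\<exists>p. \<forall>t. f (\<lambda>k. x k + t * (y k - x k)) = poly p t"
  using assms
proof induction
  case (const c)
  show ?case by (rule exI[of _ "[:c:]"]) simp
next
  case (coord f)
  then obtain k where "f = (\<lambda>x. x k)" by (auto simp: evaluations_def)
  then show ?case by (intro exI[of _ "[:x k, y k - x k:]"]) simp
next
  case (add f g)
  then obtain p q where "\<forall>t. f (\<lambda>k. x k + t * (y k - x k)) = poly p t"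
    "\<forall>t. g (\<lambda>k. x k + t * (y k - x k)) = poly q t" by blast
  then show ?case by (intro exI[of _ "p + q"]) simp
next
  case (mult f g)
  then obtain p q where "\<forall>t. f (\<lambda>k. x k + t * (y k - x k)) = poly p t"
    "\<forall>t. g (\<lambda>k. x k + t * (y k - x k)) = poly q t" by blast
  then show ?case by (intro exI[of _ "p * q"]) simp
qed

text \<open>Irreducibility of affine space. On the line through \<open>x\<close> and
  \<open>y\<close> both functions become nonzero polynomials in one variable, whose product has only
  finitely many real roots.\<close>

lemma common_nonzero:
  assumes "f \<in> polynomial_functions evaluations" "f x \<noteq> 0"
    and "g \<in> polynomial_functions evaluations" "g y \<noteq> 0"
  shows "\<exists>z. f z \<noteq> 0 \<and> g z \<noteq> 0"
proof -
  obtain p where p: "\<And>t. f (\<lambda>k. x k + t * (y k - x k)) = poly p t"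
    using polynomial_functions_on_line[OF assms(1)] by metis
  obtain q where q: "\<And>t. g (\<lambda>k. x k + t * (y k - x k)) = poly q t"
    using polynomial_functions_on_line[OF assms(3)] by metis
  have "poly p 0 \<noteq> 0" using assms(2) p[of 0] by simp
  moreover have "poly q 1 \<noteq> 0" using assms(4) q[of 1] by simp
  ultimately have "p * q \<noteq> 0" by auto
  then have "finite {t. poly (p * q) t = 0}" by (rule poly_roots_finite)
  then obtain t where "poly (p * q) t \<noteq> 0"
    using infinite_UNIV_char_0[where 'a = real] by (metis (mono_tags, lifting) UNIV_I finite_subset mem_Collect_eq subsetI)
  then show ?thesis using p q by (metis mult_eq_0_iff poly_mult)
qed

lemma common_nonzero_finite:
  assumes "finite K"
    and "\<And>k. k \<in> K \<Longrightarrow> f k \<in> polynomial_functions evaluations"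
    and "\<And>k. k \<in> K \<Longrightarrow> \<exists>x. f k x \<noteq> 0"
  shows "\<exists>x. \<forall>k\<in>K. f k x \<noteq> 0"
proof -
  \<comment> \<open>The induction carries a single polynomial, built as a product, whose
    nonvanishing implies that of every \<open>f k\<close>.\<close>
  have "\<exists>g\<in>polynomial_functions evaluations. (\<exists>x. g x \<noteq> 0) \<and> (\<forall>x. g x \<noteq> 0 \<longrightarrow> (\<forall>k\<in>K. f k x \<noteq> 0))"
    using assms
  proof (induction K rule: finite_induct)
    case empty
    show ?case by (rule bexI[of _ "\<lambda>_. 1"]) (auto intro: polynomial_functions.const)
  next
    case (insert k K)
    then obtain g x where g: "g \<in> polynomial_functions evaluations" "g x \<noteq> 0"
      "\<And>x. g x \<noteq> 0 \<Longrightarrow> \<forall>k\<in>K. f k x \<noteq> 0" by auto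
    obtain y where "f k y \<noteq> 0" using insert.prems by auto
    then obtain z where "g z \<noteq> 0" "f k z \<noteq> 0"
      using common_nonzero[OF g(1,2)] insert.prems(1) by blast
    then show ?case
      using g insert.prems(1)
      by (intro bexI[of _ "\<lambda>x. g x * f k x"]) (auto intro: polynomial_functions.mult)
  qed
  then show ?thesis by blast
qed

text \<open>Genericity enters twice: first to find normals that work for every one-edge extension at
  once, then to combine the kernel configurations separating single pairs into one that separates
  all pairs.\<close>

lemma exists_configuration_with_distinct_points:
  fixes src tgt :: "'e \<Rightarrow> 'v" and I :: "'i set"
  assumes fin: "finite V" "finite E" "finite I"
    and ends: "\<And>e. e \<in> E \<Longrightarrow> src e \<in> V \<and> tgt e \<in> V \<and> src e \<noteq> tgt e"
    and sparse: "\<And>W. W \<subseteq> V \<Longrightarrow> 2 \<le> card W \<Longrightarrow>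
      card {e\<in>E. src e \<in> W \<and> tgt e \<in> W} + card I + 1 \<le> card I * card W"
  shows "\<exists>a p. edge_surjective E src tgt I a \<and>
           (\<forall>e\<in>E. (\<Sum>i\<in>I. a e i * (p (src e) i - p (tgt e) i)) = 0) \<and>
           (\<forall>u\<in>V. \<forall>v\<in>V. u \<noteq> v \<longrightarrow> (\<exists>i\<in>I. p u i \<noteq> p v i))"
proof -
  \<comment> \<open>The edge \<open>None\<close> is the added edge joining the two vertices of a pair \<open>k \<in> K\<close>.\<close>
  define K where "K = {(u, v). u \<in> V \<and> v \<in> V \<and> u \<noteq> v}"
  have finK: "finite K"
    by (rule finite_subset[of _ "V \<times> V"]) (use fin in \<open>auto simp: K_def\<close>)
  define E' where "E' = insert None (Some ` E)"
  have finE': "finite E'" using fin by (simp add: E'_def)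
  define s where "s k = case_option (fst k) src" for k :: "'v \<times> 'v"
  define t where "t k = case_option (snd k) tgt" for k :: "'v \<times> 'v"
  have extended: "\<exists>b. edge_surjective E' (s k) (t k) I b" if k: "k \<in> K" for k
  proof (rule edge_surjective_if_sparse[OF fin(1) finE' fin(3)])
    show "s k e \<in> V \<and> t k e \<in> V \<and> s k e \<noteq> t k e" if "e \<in> E'" for e
      using that k ends by (auto simp: E'_def s_def t_def K_def)
    show "card {e\<in>E'. s k e \<in> W \<and> t k e \<in> W} + card I \<le> card I * card W"
      if W: "W \<subseteq> V" "2 \<le> card W" for W
    proof -
      let ?F = "{e\<in>E. src e \<in> W \<and> tgt e \<in> W}"
      have "{e\<in>E'. s k e \<in> W \<and> t k e \<in> W} \<subseteq> insert None (Some ` ?F)"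
        by (auto simp: E'_def s_def t_def)
      then have "card {e\<in>E'. s k e \<in> W \<and> t k e \<in> W} \<le> card (insert None (Some ` ?F))"
        using fin by (intro card_mono) auto
      also have "\<dots> = Suc (card ?F)"
        using fin by (simp add: card_image image_iff)
      finally show ?thesis using sparse[OF W] by linarith
    qed
  qed
  \<comment> \<open>The unknowns are indexed by \<open>'e option \<times> 'i\<close> for every pair
    \<open>k\<close>, so the polynomials for different pairs live on the same space and have a
    common nonzero \<open>x\<close>.\<close>
  define good where "good k f \<longleftrightarrow> f \<in> polynomial_functions evaluations \<and> (\<exists>x. f x \<noteq> 0) \<and>
      (\<forall>x. f x \<noteq> 0 \<longrightarrow> edge_surjective E' (s k) (t k) I (\<lambda>e i. x (e, i)))" for k f
  have "\<exists>f. good k f" if k: "k \<in> K" for k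
  proof -
    obtain b where b: "edge_surjective E' (s k) (t k) I b" using extended[OF k] by blast
    have "\<exists>f\<in>polynomial_functions evaluations. f (\<lambda>(e, i). b e i) \<noteq> 0 \<and>
      (\<forall>x. f x \<noteq> 0 \<longrightarrow> edge_surjective E' (s k) (t k) I (\<lambda>e i. x (e, i)))"
    proof (rule edge_surjective_zariski_open[OF finE'])
      show "(\<lambda>x. x (e, i)) \<in> polynomial_functions evaluations" for e :: "'e option" and i :: 'i
        by (rule polynomial_functions.coord) (auto simp: evaluations_def)
    qed (use b in simp)
    then show ?thesis unfolding good_def by blast
  qed
  then obtain f where f: "\<And>k. k \<in> K \<Longrightarrow> good k (f k)" by metis
  obtain x where "\<forall>k\<in>K. f k x \<noteq> 0"
    using common_nonzero_finite[of K f, OF finK] f unfolding good_def by blast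
  then have surj: "edge_surjective E' (s k) (t k) I (\<lambda>e i. x (e, i))" if "k \<in> K" for k
    using that f unfolding good_def by blast
  define a where "a e i = x (Some e, i)" for e i
  define b where "b i = x (None, i)" for i
  have ex_q: "\<exists>q. (\<forall>e\<in>E. (\<Sum>i\<in>I. a e i * (q (src e) i - q (tgt e) i)) = y e) \<and>
      (\<Sum>i\<in>I. b i * (q (fst k) i - q (snd k) i)) = z"
    if k: "k \<in> K" for k y z
  proof -
    obtain q where q: "\<forall>e\<in>E'. (\<Sum>i\<in>I. x (e, i) * (q (s k e) i - q (t k e) i)) = case_option z y e"
      using surj[OF k, unfolded edge_surjective_def, rule_format, of "case_option z y"] by blast
    show ?thesis
    proof (intro exI conjI ballI)
      show "(\<Sum>i\<in>I. a e i * (q (src e) i - q (tgt e) i)) = y e" if "e \<in> E" for e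
        using q[rule_format, of "Some e"] that by (simp add: E'_def s_def t_def a_def)
      show "(\<Sum>i\<in>I. b i * (q (fst k) i - q (snd k) i)) = z"
        using q[rule_format, of None] by (simp add: E'_def s_def t_def b_def)
    qed
  qed
  have surjE: "edge_surjective E src tgt I a"
  \<comment> \<open>Surjectivity for any one extension restricts to \<open>E\<close>. An extending
    pair exists as soon as there is an edge, since the ends of an edge form one.\<close>
  proof (cases "E = {}")
    case False
    then obtain e where "e \<in> E" by blast
    then have "(src e, tgt e) \<in> K" using ends by (auto simp: K_def)
    from ex_q[OF this] show ?thesis unfolding edge_surjective_def by blast
  qed (simp add: edge_surjective_def)
  \<comment> \<open>Target 0 on \<open>E\<close> and 1 on the added edge: \<open>q\<close> is in the
    kernel, yet its two points at the pair \<open>k\<close> differ.\<close>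
  define sep where "sep k q \<longleftrightarrow> (\<forall>e\<in>E. (\<Sum>i\<in>I. a e i * (q (src e) i - q (tgt e) i)) = 0) \<and>
      (\<Sum>i\<in>I. b i * (q (fst k) i - q (snd k) i)) = 1" for k q
  have "\<exists>q. sep k q" if "k \<in> K" for k
    unfolding sep_def using that by (rule ex_q)
  then obtain q where q: "\<And>k. k \<in> K \<Longrightarrow> sep k (q k)" by metis
  have q0: "k \<in> K \<Longrightarrow> e \<in> E \<Longrightarrow>
        (\<Sum>i\<in>I. a e i * (q k (src e) i - q k (tgt e) i)) = 0" for k e
    using q unfolding sep_def by blast
  have q1: "k \<in> K \<Longrightarrow> (\<Sum>i\<in>I. b i * (q k (fst k) i - q k (snd k) i)) = 1" for k
    using q unfolding sep_def by blast
  \<comment> \<open>The offset along \<open>b\<close> across the pair \<open>k\<close> in the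
    combination of the \<open>q l\<close> with coefficients \<open>\<tau>\<close>. It is linear in
    \<open>\<tau>\<close> and equals 1 at the unit function of \<open>k\<close>.\<close>
  define g where "g k \<tau> = (\<Sum>l\<in>K. \<tau> l * (\<Sum>i\<in>I. b i * (q l (fst k) i - q l (snd k) i)))"
    for k and \<tau> :: "'v \<times> 'v \<Rightarrow> real"
  have "\<exists>\<tau>. \<forall>k\<in>K. g k \<tau> \<noteq> 0"
  proof (rule common_nonzero_finite[OF finK])
    show "g k \<in> polynomial_functions evaluations" for k
      unfolding g_def
      by (intro polynomial_functions_sum polynomial_functions.mult polynomial_functions.const
          polynomial_functions.coord) (auto simp: evaluations_def)
    show "\<exists>\<tau>. g k \<tau> \<noteq> 0" if "k \<in> K" for k
    proof
      have "g k (unit_fun k) =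
          (\<Sum>l\<in>K. if l = k then \<Sum>i\<in>I. b i * (q l (fst k) i - q l (snd k) i) else 0)"
        unfolding g_def by (rule sum.cong) (auto simp: unit_fun_def)
      then show "g k (unit_fun k) \<noteq> 0" using finK that q1[OF that] by simp
    qed
  qed
  then obtain \<tau> where \<tau>: "\<And>k. k \<in> K \<Longrightarrow> g k \<tau> \<noteq> 0" by blast
  define p where "p v i = (\<Sum>l\<in>K. \<tau> l * q l v i)" for v i
  have p_diff: "(\<Sum>i\<in>I. c i * (p u i - p v i)) =
      (\<Sum>l\<in>K. \<tau> l * (\<Sum>i\<in>I. c i * (q l u i - q l v i)))" for c u v
  proof -
    have "(\<Sum>i\<in>I. c i * (p u i - p v i)) = (\<Sum>i\<in>I. \<Sum>l\<in>K. \<tau> l * (c i * (q l u i - q l v i)))"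
      by (simp add: p_def sum_distrib_left algebra_simps flip: sum_subtractf)
    then show ?thesis by (subst (asm) sum.swap) (simp add: sum_distrib_left)
  qed
  show ?thesis
  proof (intro exI conjI ballI impI)
    show "edge_surjective E src tgt I a" by (rule surjE)
    show "(\<Sum>i\<in>I. a e i * (p (src e) i - p (tgt e) i)) = 0" if "e \<in> E" for e
      using q0 that by (simp add: p_diff)
    show "\<exists>i\<in>I. p u i \<noteq> p v i" if "u \<in> V" "v \<in> V" "u \<noteq> v" for u v
    proof (rule ccontr)
      assume "\<not> (\<exists>i\<in>I. p u i \<noteq> p v i)"
      then have "(\<Sum>i\<in>I. b i * (p u i - p v i)) = 0" by simp
      then have "g (u, v) \<tau> = 0" by (simp add: p_diff g_def)
      then show False using \<tau>[of "(u, v)"] that by (simp add: K_def)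
    qed
  qed
qed

section \<open>Vanishing of the first cohomology\<close>

lemma additive_nat_pow: "(x :: 'a::real_vector) [^]\<^bsub>additive_group\<^esub> (n::nat) = real n *\<^sub>R x"
  by (induction n) (simp_all add: additive_group_def nat_pow_def algebra_simps)

lemma additive_int_pow: "(x :: 'a::real_vector) [^]\<^bsub>additive_group\<^esub> (k::int) = real_of_int k *\<^sub>R x"
  by (simp add: int_pow_def2 additive_nat_pow inv_additive)

text \<open>With \<open>h\<close> the projection onto a quotient, this computes the coboundary on
  representatives: the group product with signed powers is the class of a signed sum of
  vectors.\<close>

lemma finprod_hom_additive:
  fixes f :: "'v \<Rightarrow> 'a::real_vector"
  assumes "comm_group H" "h \<in> hom additive_group H" "finite A"
  shows "finprod H (\<lambda>v. h (f v) [^]\<^bsub>H\<^esub> (s v :: int)) A = h (\<Sum>v\<in>A. real_of_int (s v) *\<^sub>R f v)"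
proof -
  interpret A: comm_group "additive_group :: 'a monoid" by (rule comm_group_additive)
  interpret H: comm_group H by fact
  interpret h: group_hom "additive_group :: 'a monoid" H h
    by unfold_locales (rule assms(2))
  have UNIV: "x \<in> carrier additive_group" for x :: 'a by (simp add: additive_group_def)
  have pow: "h (f v) [^]\<^bsub>H\<^esub> s v = h (real_of_int (s v) *\<^sub>R f v)" for v
    by (metis UNIV additive_int_pow h.hom_int_pow)
  have add: "h x \<otimes>\<^bsub>H\<^esub> h y = h (x + y)" for x y
    using h.hom_mult[OF UNIV UNIV, of x y] by (simp add: additive_group_def)
  show ?thesis
    using assms(3)
  proof (induction A rule: finite_induct)
    case empty
    show ?case using h.hom_one by (simp add: additive_group_def)
  next
    case (insert v A)
    have "finprod H (\<lambda>v. h (f v) [^]\<^bsub>H\<^esub> s v) (insert v A) =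
        h (f v) [^]\<^bsub>H\<^esub> s v \<otimes>\<^bsub>H\<^esub> finprod H (\<lambda>v. h (f v) [^]\<^bsub>H\<^esub> s v) A"
      using insert.hyps UNIV h.hom_closed by (intro H.finprod_insert) auto
    then show ?case using insert pow add by simp
  qed
qed

lemma trivial_group_Mod_carrier:
  assumes "group G" shows "trivial_group (G Mod carrier G)"
proof -
  interpret group G by fact
  have "carrier G \<lhd> G" by (simp add: group.normal_self assms)
  then have "group (G Mod carrier G)" by (rule normal.factorgroup_is_group)
  moreover have "carrier (G Mod carrier G) = {carrier G}"
    using coset_join2[OF _ subgroup_self] by (force simp: carrier_FactGroup)
  ultimately show ?thesis by (simp add: trivial_group_def)
qed

text \<open>A coset of the kernel of a functional is determined by the value of the functional on
  it, so surjectivity of the coboundary becomes a system of scalar equations. The targets are values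
  of the functionals, which also covers a zero functional, whose edge stalk is trivial.\<close>

lemma trivial_H1:
  fixes p :: "('v, 'e, 'n::finite) point"
  assumes "multigraph V E ends"
    and restr: "\<And>e v. e \<in> E \<Longrightarrow> v \<in> ends e \<Longrightarrow> subspace_of (fst p v) \<subseteq> kern (snd p e)"
    and surj: "\<And>y. \<exists>w. \<forall>e\<in>E.
      (\<Sum>v\<in>ends e. real_of_int (sg v e) * blinfun_apply (snd p e) (w v)) = blinfun_apply (snd p e) (y e)"
  shows "trivial_group (H1 V E ends sg (sheaf_of p))"
proof -
  let ?A = "additive_group :: (real^'n) monoid"
  let ?F = "sheaf_of p"
  define N where "N e = kern (snd p e)" for e
  have ends: "ends e \<subseteq> V" "finite (ends e)" if "e \<in> E" for e
    using assms(1) that finite_subset unfolding multigraph_def by blast+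
  have estalk: "estalk ?F e = ?A Mod N e" for e
    by (simp add: sheaf_of_def N_def)
  have vstalk: "vstalk ?F v = ?A Mod subspace_of (fst p v)" for v
    by (simp add: sheaf_of_def)
  have carr: "carrier (?A Mod S) = range (\<lambda>x. S #>\<^bsub>?A\<^esub> x)" for S
    by (simp add: carrier_FactGroup additive_group_def)
  have cg: "comm_group (?A Mod N e)" for e
    unfolding N_def by (rule comm_group_quotient) (rule subspace_kern)
  have normal: "N e \<lhd> ?A" for e
    unfolding N_def using comm_group_additive subgroup_additive[OF subspace_kern]
    by (rule comm_group.subgroup_imp_normal)
  have group1: "group (C1 E ?F)"
    unfolding C1_def by (rule product_group) (simp add: estalk comm_group.axioms(2) cg)
  \<comment> \<open>Each restriction map only enlarges the subgroup of the coset and keeps the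
    representative \<open>w v\<close>.\<close>
  have cob: "coboundary E ends sg ?F (\<lambda>v\<in>V. subspace_of (fst p v) #>\<^bsub>?A\<^esub> w v) =
      (\<lambda>e\<in>E. N e #>\<^bsub>?A\<^esub> (\<Sum>v\<in>ends e. real_of_int (sg v e) *\<^sub>R w v))" for w
    unfolding coboundary_def
  proof (rule restrict_ext)
    fix e assume e: "e \<in> E"
    have "finprod (?A Mod N e) (\<lambda>v. restr ?F v e ((\<lambda>v\<in>V. subspace_of (fst p v) #>\<^bsub>?A\<^esub> w v) v)
        [^]\<^bsub>?A Mod N e\<^esub> sg v e) (ends e) =
      finprod (?A Mod N e) (\<lambda>v. (N e #>\<^bsub>?A\<^esub> w v) [^]\<^bsub>?A Mod N e\<^esub> sg v e) (ends e)"
    proof (rule comm_monoid.finprod_cong'[OF _ refl])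
      show "comm_monoid (?A Mod N e)" using cg comm_group.axioms(1) by blast
      show "(\<lambda>v. (N e #>\<^bsub>?A\<^esub> w v) [^]\<^bsub>?A Mod N e\<^esub> sg v e) \<in> ends e \<rightarrow> carrier (?A Mod N e)"
        by (intro Pi_I group.int_pow_closed comm_group.axioms(2) cg) (simp add: carr)
      fix v assume v: "v \<in> ends e"
      then have "v \<in> V" using ends e by blast
      then show "restr ?F v e ((\<lambda>v\<in>V. subspace_of (fst p v) #>\<^bsub>?A\<^esub> w v) v) [^]\<^bsub>?A Mod N e\<^esub> sg v e =
          (N e #>\<^bsub>?A\<^esub> w v) [^]\<^bsub>?A Mod N e\<^esub> sg v e"
        using reduction_coset[OF restr[OF e v]] by (simp add: sheaf_of_def N_def)
    qed
    also have "\<dots> = N e #>\<^bsub>?A\<^esub> (\<Sum>v\<in>ends e. real_of_int (sg v e) *\<^sub>R w v)"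
      using cg normal.r_coset_hom_Mod[OF normal] ends(2)[OF e] by (rule finprod_hom_additive)
    finally show "finprod (estalk ?F e) (\<lambda>v. restr ?F v e ((\<lambda>v\<in>V. subspace_of (fst p v) #>\<^bsub>?A\<^esub> w v) v)
        [^]\<^bsub>estalk ?F e\<^esub> sg v e) (ends e) =
        N e #>\<^bsub>?A\<^esub> (\<Sum>v\<in>ends e. real_of_int (sg v e) *\<^sub>R w v)"
      unfolding estalk .
  qed
  have C0: "carrier (C0 V ?F) = (\<Pi>\<^sub>E v\<in>V. range (\<lambda>x. subspace_of (fst p v) #>\<^bsub>?A\<^esub> x))"
    by (simp add: C0_def vstalk carr)
  have C1: "carrier (C1 E ?F) = (\<Pi>\<^sub>E e\<in>E. range (\<lambda>x. N e #>\<^bsub>?A\<^esub> x))"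
    by (simp add: C1_def estalk carr)
  have "coboundary E ends sg ?F ` carrier (C0 V ?F) = carrier (C1 E ?F)"
  proof (intro equalityI subsetI)
    fix z assume "z \<in> coboundary E ends sg ?F ` carrier (C0 V ?F)"
    then obtain c where c: "c \<in> carrier (C0 V ?F)" "z = coboundary E ends sg ?F c" by blast
    then have "\<forall>v\<in>V. \<exists>x. c v = subspace_of (fst p v) #>\<^bsub>?A\<^esub> x"
      unfolding C0 by blast
    then obtain w where w: "\<And>v. v \<in> V \<Longrightarrow> c v = subspace_of (fst p v) #>\<^bsub>?A\<^esub> w v" by metis
    have "c = (\<lambda>v\<in>V. subspace_of (fst p v) #>\<^bsub>?A\<^esub> w v)"
      using c(1) w unfolding C0 by (auto simp: PiE_iff extensional_def restrict_def fun_eq_iff)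
    then show "z \<in> carrier (C1 E ?F)"
      unfolding c(2) C1 using cob[of w] by auto
  next
    fix z assume z: "z \<in> carrier (C1 E ?F)"
    then have "\<forall>e\<in>E. \<exists>x. z e = N e #>\<^bsub>?A\<^esub> x" unfolding C1 by blast
    then obtain y where y: "\<And>e. e \<in> E \<Longrightarrow> z e = N e #>\<^bsub>?A\<^esub> y e" by metis
    obtain w where w: "\<And>e. e \<in> E \<Longrightarrow>
        (\<Sum>v\<in>ends e. real_of_int (sg v e) * blinfun_apply (snd p e) (w v)) = blinfun_apply (snd p e) (y e)"
      using surj by blast
    have "coboundary E ends sg ?F (\<lambda>v\<in>V. subspace_of (fst p v) #>\<^bsub>?A\<^esub> w v) = z"
    proof
      fix e
      show "coboundary E ends sg ?F (\<lambda>v\<in>V. subspace_of (fst p v) #>\<^bsub>?A\<^esub> w v) e = z e"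
      proof (cases "e \<in> E")
        case True
        let ?s = "\<Sum>v\<in>ends e. real_of_int (sg v e) *\<^sub>R w v"
        have "blinfun_apply (snd p e) ?s = blinfun_apply (snd p e) (y e)"
          using w[OF True] by (simp add: blinfun.sum_right blinfun.scaleR_right)
        then have "?s - y e \<in> N e" by (simp add: N_def kern_def blinfun.diff_right)
        then have "?s \<in> N e #>\<^bsub>?A\<^esub> y e"
          unfolding r_coset_def additive_group_def by force
        then have "N e #>\<^bsub>?A\<^esub> ?s = N e #>\<^bsub>?A\<^esub> y e"
          using group.repr_independence[OF comm_group.axioms(2)[OF comm_group_additive]]
            normal_imp_subgroup[OF normal] by (metis UNIV_I additive_group_def partial_object.simps(1))
        then show ?thesis using True y cob by simp
      next
        case False
        then show ?thesis using z unfolding C1 by (auto simp: coboundary_def PiE_iff extensional_def)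
      qed
    qed
    moreover have "(\<lambda>v\<in>V. subspace_of (fst p v) #>\<^bsub>?A\<^esub> w v) \<in> carrier (C0 V ?F)"
      unfolding C0 by auto
    ultimately show "z \<in> coboundary E ends sg ?F ` carrier (C0 V ?F)" by blast
  qed
  then show ?thesis
    unfolding H1_def using trivial_group_Mod_carrier[OF group1] by simp
qed

section \<open>Realization by lines and functionals\<close>

definition line_projection :: "real^'n \<Rightarrow> real^'n^'n" where
  "line_projection s = (\<chi> i j. s $ i * s $ j / (s \<bullet> s))"

lemma line_projection_mult: "line_projection s *v x = ((s \<bullet> x) / (s \<bullet> s)) *\<^sub>R s"
  by (simp add: line_projection_def matrix_vector_mult_def vec_eq_iff inner_vec_def
      sum_divide_distrib sum_distrib_left sum_distrib_right mult_ac)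

lemma line_projection_in_grassmannian:
  assumes "s \<noteq> 0"
  shows "line_projection s \<in> grassmannian 1"
proof -
  let ?P = "line_projection s"
  have "transpose ?P = ?P"
    by (simp add: line_projection_def transpose_def mult.commute)
  moreover have "?P ** ?P = ?P"
    by (rule matrix_eq[THEN iffD2])
      (use assms in \<open>simp add: line_projection_mult flip: matrix_vector_mul_assoc\<close>)
  moreover have "trace ?P = 1"
  proof -
    have "trace ?P = (s \<bullet> s) / (s \<bullet> s)"
      by (simp add: trace_def line_projection_def inner_vec_def flip: sum_divide_distrib)
    then show ?thesis using assms by simp
  qed
  ultimately show ?thesis by (simp add: grassmannian_def)
qed

lemma subspace_of_line_projection: "x \<in> subspace_of (line_projection s) \<Longrightarrow> \<exists>c. x = c *\<^sub>R s"
  by (auto simp: subspace_of_def line_projection_mult)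

lemma blinfun_apply_axis_sum:
  fixes a :: "(real^'n) \<Rightarrow>\<^sub>L real"
  shows "blinfun_apply a x = (\<Sum>i\<in>UNIV. blinfun_apply a (axis i 1) * x $ i)"
proof -
  have "blinfun_apply a x = blinfun_apply a (\<Sum>i\<in>UNIV. x $ i *\<^sub>R axis i 1)"
    by (simp add: basis_expansion flip: scalar_mult_eq_scaleR)
  then show ?thesis by (simp add: blinfun.sum_right blinfun.scaleR_right mult.commute)
qed

theorem mainTheorem4:
  fixes V :: "'v set" and E :: "'e set" and ends :: "'e \<Rightarrow> 'v set"
    and sg :: "'v \<Rightarrow> 'e \<Rightarrow> int"
  assumes "CARD('n::finite) \<ge> 3"
    and "multigraph V E ends"
    and "sparse_multigraph (CARD('n) - 1) (CARD('n)) V E ends"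
    and "incidence_signs E ends sg"
  shows "\<exists>U :: ('v, 'e, 'n) point set.
           openin (Z_space 1 V E ends) U \<and> U \<noteq> {} \<and>
           (\<forall>p\<in>U. trivial_group (H1 V E ends sg (sheaf_of p)))"
proof -
  have fin: "finite V" "finite E"
    using assms(2) by (auto simp: multigraph_def)
  have "\<forall>e\<in>E. \<exists>u v. ends e = {u, v} \<and> u \<noteq> v"
    using assms(2) by (auto simp: multigraph_def card_2_iff)
  then obtain src tgt where st: "\<And>e. e \<in> E \<Longrightarrow> ends e = {src e, tgt e} \<and> src e \<noteq> tgt e"
    by metis
  have ends: "src e \<in> V \<and> tgt e \<in> V \<and> src e \<noteq> tgt e" if "e \<in> E" for e
    using st[OF that] assms(2) that by (auto simp: multigraph_def)
  \<comment> \<open>An arbitrary coordinate, serving as the homogenizing one; \<open>I\<close>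
    indexes the affine coordinates.\<close>
  obtain i0 :: 'n where True by blast
  define I :: "'n set" where "I = UNIV - {i0}"
  have finI: "finite I" by (simp add: I_def)
  have cardI: "CARD('n) = card I + 1"
    using assms(1) by (simp add: I_def card_Diff_singleton)
  have sum_UNIV: "(\<Sum>i\<in>UNIV. g i) = g i0 + (\<Sum>i\<in>I. g i)" for g :: "'n \<Rightarrow> real"
    unfolding I_def by (simp add: sum.remove)
  \<comment> \<open>For \<open>d = card I\<close> the dimension is \<open>d + 1\<close>, so the
    sparsity assumption is (d,d+1)-sparsity.\<close>
  have sparse: "card {e\<in>E. src e \<in> W \<and> tgt e \<in> W} + card I + 1 \<le> card I * card W"
    if W: "W \<subseteq> V" "2 \<le> card W" for W
  proof -
    have "{e\<in>E. src e \<in> W \<and> tgt e \<in> W} = {e\<in>E. ends e \<subseteq> W}" using st by auto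
    moreover have "int (card {e\<in>E. ends e \<subseteq> W}) \<le> int (card I) * int (card W) - int (card I + 1)"
      using assms(3) W unfolding sparse_multigraph_def cardI by simp
    ultimately have "int (card {e\<in>E. src e \<in> W \<and> tgt e \<in> W} + card I + 1) \<le> int (card I * card W)"
      by simp
    then show ?thesis by (simp only: of_nat_le_iff)
  qed
  have "\<exists>a p. edge_surjective E src tgt I a \<and>
      (\<forall>e\<in>E. (\<Sum>i\<in>I. a e i * (p (src e) i - p (tgt e) i)) = 0) \<and>
      (\<forall>u\<in>V. \<forall>v\<in>V. u \<noteq> v \<longrightarrow> (\<exists>i\<in>I. p u i \<noteq> p v i))"
    by (rule exists_configuration_with_distinct_points[OF fin finI ends sparse])
  then obtain a p where ap: "edge_surjective E src tgt I a \<and>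
      (\<forall>e\<in>E. (\<Sum>i\<in>I. a e i * (p (src e) i - p (tgt e) i)) = 0) \<and>
      (\<forall>u\<in>V. \<forall>v\<in>V. u \<noteq> v \<longrightarrow> (\<exists>i\<in>I. p u i \<noteq> p v i))"
    by (elim exE) (rule that)
  then have surj: "edge_surjective E src tgt I a"
    and ker: "e \<in> E \<Longrightarrow> (\<Sum>i\<in>I. a e i * (p (src e) i - p (tgt e) i)) = 0"
    and dist: "u \<in> V \<Longrightarrow> v \<in> V \<Longrightarrow> u \<noteq> v \<Longrightarrow> \<exists>i\<in>I. p u i \<noteq> p v i" for e u v
    by simp_all
  \<comment> \<open>\<open>s v\<close> is the affine point \<open>p v\<close> in homogeneous coordinates, and \<open>\<alpha> e\<close> the hyperplane with
    normal \<open>a e\<close> through \<open>p (src e)\<close>, which contains \<open>p (tgt e)\<close> by \<open>ker\<close>.\<close>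
  define s :: "'v \<Rightarrow> real^'n" where "s v = (\<chi> i. if i = i0 then 1 else p v i)" for v
  define \<alpha> :: "'e \<Rightarrow> real^'n"
    where "\<alpha> e = (\<chi> i. if i = i0 then - (\<Sum>i\<in>I. a e i * p (src e) i) else a e i)" for e
  have s_nth: "s v $ i0 = 1" "i \<in> I \<Longrightarrow> s v $ i = p v i" for v i
    by (auto simp: s_def I_def)
  have \<alpha>_nth: "i \<in> I \<Longrightarrow> \<alpha> e $ i = a e i" for e i
    by (auto simp: \<alpha>_def I_def)
  have \<alpha>_s: "\<alpha> e \<bullet> s v = (\<Sum>i\<in>I. a e i * p v i) - (\<Sum>i\<in>I. a e i * p (src e) i)" for e v
    by (simp add: inner_vec_def sum_UNIV s_nth \<alpha>_nth) (simp add: \<alpha>_def)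
  have incident: "\<alpha> e \<bullet> s v = 0" if "e \<in> E" "v \<in> ends e" for e v
    using ker[OF that(1)] that(2) st[OF that(1)]
    by (auto simp: \<alpha>_s right_diff_distrib sum_subtractf)
  have s_nz: "s v \<noteq> 0" for v
    using s_nth(1)[of v] by (metis zero_index zero_neq_one)
  define pt :: "('v, 'e, 'n) point"
    where "pt = (\<lambda>v\<in>V. line_projection (s v), \<lambda>e\<in>E. blinfun_inner_right (\<alpha> e))"
  have in_V: "v \<in> V" if "e \<in> E" "v \<in> ends e" for e v
    using that(2) st[OF that(1)] ends[OF that(1)] by auto
  have vanish: "\<alpha> e \<bullet> x = 0"
    if "e \<in> E" "v \<in> ends e" "x \<in> subspace_of (line_projection (s v))" for e v x
    using subspace_of_line_projection[OF that(3)] incident[OF that(1,2)] by auto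
  \<comment> \<open>Both spanning vectors have coordinate 1 at \<open>i0\<close>, so a common
    nonzero multiple would make the distinct points \<open>p u\<close> and \<open>p v\<close>
    equal.\<close>
  have transversal: "subspace_of (line_projection (s u)) \<inter> subspace_of (line_projection (s v)) = {0}"
    if uv: "u \<in> V" "v \<in> V" "u \<noteq> v" for u v
  proof
    show "subspace_of (line_projection (s u)) \<inter> subspace_of (line_projection (s v)) \<subseteq> {0}"
    proof
      fix x assume "x \<in> subspace_of (line_projection (s u)) \<inter> subspace_of (line_projection (s v))"
      then obtain c c' where c: "x = c *\<^sub>R s u" "x = c' *\<^sub>R s v"
        by (meson IntE subspace_of_line_projection)
      obtain i where i: "i \<in> I" "p u i \<noteq> p v i" using dist[OF uv] by blast
      have "x $ i0 = c" "x $ i = c * p u i" using s_nth i(1) by (simp_all add: c(1))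
      moreover have "x $ i0 = c'" "x $ i = c' * p v i" using s_nth i(1) by (simp_all add: c(2))
      ultimately have "c = 0" using i(2) by (metis mult_cancel_left)
      then show "x \<in> {0}" using c by simp
    qed
  qed (simp add: subspace_0[OF subspace_subspace_of])
  have pt: "pt \<in> Z_set 1 V E ends"
    unfolding Z_set_def pt_def
    by (simp add: in_V vanish transversal line_projection_in_grassmannian[OF s_nz] del: One_nat_def)
  \<comment> \<open>Among the coordinate functions on the parameter space, those with
    \<open>i \<in> I\<close> give the normals; at \<open>pt\<close> they take the values
    \<open>a e i\<close>.\<close>
  define b where "b e i q = blinfun_apply (snd q e) (axis i 1)" for e i and q :: "('v, 'e, 'n) point"
  have "b e i pt = a e i" if "e \<in> E" "i \<in> I" for e i
    using that by (simp add: b_def pt_def inner_axis \<alpha>_nth)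
  then have "edge_surjective E src tgt I (\<lambda>e i. b e i pt)"
    using surj unfolding edge_surjective_def by simp
  moreover have "b e i \<in> polynomial_functions (coordinates V E)" if "e \<in> E" for e i
    unfolding b_def using that by (intro polynomial_functions.coord) (auto simp: coordinates_def)
  ultimately have "\<exists>f\<in>polynomial_functions (coordinates V E). f pt \<noteq> 0 \<and>
      (\<forall>q. f q \<noteq> 0 \<longrightarrow> edge_surjective E src tgt I (\<lambda>e i. b e i q))"
    by (intro edge_surjective_zariski_open[OF fin(2)])
  then obtain f where f: "f \<in> polynomial_functions (coordinates V E)" "f pt \<noteq> 0"
    and f_surj: "\<forall>q. f q \<noteq> 0 \<longrightarrow> edge_surjective E src tgt I (\<lambda>e i. b e i q)"
    by (elim bexE conjE) (rule that)
  define U where "U = {q. f q \<noteq> 0} \<inter> Z_set 1 V E ends"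
  have "zariski_open (coordinates V E) {q. f q \<noteq> 0}"
    unfolding zariski_open_def by (rule exI[of _ "{f}"]) (use f in \<open>auto simp: zero_locus_def\<close>)
  then have "openin (Z_space 1 V E ends) U"
    unfolding Z_space_def U_def openin_subtopology openin_zariski by blast
  moreover have "U \<noteq> {}" using pt f by (auto simp: U_def)
  moreover have "trivial_group (H1 V E ends sg (sheaf_of q))" if q: "q \<in> U" for q
  proof (rule trivial_H1[OF assms(2)])
    show "subspace_of (fst q v) \<subseteq> kern (snd q e)" if "e \<in> E" "v \<in> ends e" for e v
      using q that by (auto simp: U_def Z_set_def kern_def)
    fix y :: "'e \<Rightarrow> real^'n"
    have "edge_surjective E src tgt I (\<lambda>e i. b e i q)"
      using q by (intro f_surj[rule_format]) (simp add: U_def)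
    \<comment> \<open>The coboundary at \<open>e\<close> is the sign at \<open>src e\<close> times a
      difference. The same sign in the target cancels it, as its square is 1.\<close>
    then obtain w where w: "\<forall>e\<in>E. (\<Sum>i\<in>I. b e i q * (w (src e) i - w (tgt e) i)) =
        real_of_int (sg (src e) e) * blinfun_apply (snd q e) (y e)"
      unfolding edge_surjective_def by (elim allE exE) (rule that)
    \<comment> \<open>The value 0 at \<open>i0\<close> leaves only the coefficients of the
      functional indexed by \<open>I\<close>.\<close>
    define w' :: "'v \<Rightarrow> real^'n" where "w' v = (\<chi> i. if i \<in> I then w v i else 0)" for v
    have app: "blinfun_apply (snd q e) (w' v) = (\<Sum>i\<in>I. b e i q * w v i)" for e v
    proof -
      have "i0 \<notin> I" by (simp add: I_def)
      then show ?thesis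
        by (subst blinfun_apply_axis_sum) (simp add: sum_UNIV w'_def b_def)
    qed
    have "(\<Sum>v\<in>ends e. real_of_int (sg v e) * blinfun_apply (snd q e) (w' v)) =
        blinfun_apply (snd q e) (y e)" if e: "e \<in> E" for e
    proof -
      have sg: "sg (tgt e) e = - sg (src e) e" "sg (src e) e \<in> {1, -1}"
        using assms(4) e st[OF e] unfolding incidence_signs_def by auto
      have "(\<Sum>v\<in>ends e. real_of_int (sg v e) * blinfun_apply (snd q e) (w' v)) =
          real_of_int (sg (src e) e) * (\<Sum>i\<in>I. b e i q * (w (src e) i - w (tgt e) i))"
        using st[OF e] sg(1) by (simp add: app right_diff_distrib sum_subtractf)
      then show ?thesis using w e sg(2) by auto
    qed
    then show "\<exists>w. \<forall>e\<in>E. (\<Sum>v\<in>ends e. real_of_int (sg v e) * blinfun_apply (snd q e) (w v)) =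
        blinfun_apply (snd q e) (y e)"
      by (intro exI[of _ w'] ballI)
  qed
  ultimately show ?thesis by (intro exI[of _ U]) blast
qed

end
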